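(* Let $\tau,\sigma>0$ with $\lambda=\sigma/\tau$, let $L=\|K\|$, and let $(X^n,Y^n)$ and $(\tilde X^n,\tilde Y^n)$ be two instances of the primal-dual Langevin iteration $$\left\{\begin{array}{l}Y^{n+1}=\mathrm{prox}_{\sigma f^\ast}(Y^n+\sigma KX_\theta^n)\\ X^{n+1}=\mathrm{prox}_{\tau g}(X^n-\tau K^TY^{n+1})+\sqrt{2\tau}\,\xi^{n+1}\\ X_\theta^{n+1}=X^{n+1}+\theta(X^{n+1}-X^n)\end{array}\right.$$ with $X_\theta^0=X^0$, relaxation parameter $\theta=1$, coupled by using the same independent Gaussian inputs $\xi^{n+1}\sim\mathrm{N}(0,I_d)$, and with $(X^0,Y^0)\sim\pi_0$, $(\tilde X^0,\tilde Y^0)\sim\tilde\pi_0$. Denote by $\pi_n,\tilde\pi_n$ the laws of $(X^n,Y^n)$, $(\tilde X^n,\tilde Y^n)$ and by $\mu_n,\tilde\mu_n$ the laws of $X^n,\tilde X^n$. If $\tau\sigma L^2\le1$, then for all $N$ $$\mathcal{W}_2(\mu_N,\tilde\mu_N)\le\mathcal{T}_{1,\lambda^{-1}}(\pi_0,\tilde\pi_0).$$ If $\tau\sigma L^2<1$, then with $C=(1-\tau\sigma L^2)^{-1/2}$ $$\mathcal{T}_{1,\lambda^{-1}}(\pi_N,\tilde\pi_N)\le C\,\mathcal{T}_{1,\lambda^{-1}}(\pi_0,\tilde\pi_0).$$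
   Context: $\mathcal{X}=\mathbb{R}^d$, $\mathcal{Y}=\mathbb{R}^m$, $\mathcal{Z}=\mathcal{X}\times\mathcal{Y}$; $K:\mathcal{X}\to\mathcal{Y}$ is linear with Euclidean operator norm $\|K\|$; $f:\mathcal{Y}\to\mathbb{R}\cup\{\infty\}$ and $g:\mathcal{X}\to\mathbb{R}\cup\{\infty\}$ are convex and lower semicontinuous with $0<\int\exp(-f(Kx)-g(x))dx<\infty$; $f^\ast(y)=\sup_x\{\langle x,y\rangle-f(x)\}$; $\mathrm{prox}_{\gamma\phi}=(\mathrm{id}+\gamma\partial\phi)^{-1}$. The $\xi^n$ are i.i.d. and independent of the initial values; initial laws have finite second moment. $\mathcal{W}_2$ is the 2-Wasserstein distance, and for $a,b>0$ $$\mathcal{T}_{a,b}(\pi,\tilde\pi)=\inf\left(\mathbb{E}\left[a\|x-\tilde x\|^2+b\|y-\tilde y\|^2\right]\right)^{1/2},$$ the infimum over all couplings of $(x,y)\sim\pi$ and $(\tilde x,\tilde y)\sim\tilde\pi$, for $\pi,\tilde\pi\in\mathcal{P}_2(\mathcal{Z})$. *)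

theory Defs
  imports "HOL-Probability.Probability"
begin

section \<open>Convex analysis for extended-real-valued functions\<close>

text \<open>
  A function with values in the reals extended by plus infinity is an \<open>ereal\<close>-valued function that
  never takes the value \<open>-\<infinity>\<close>; this is a hypothesis wherever it is needed.
\<close>

definition ereal_convex :: "('a::real_vector \<Rightarrow> ereal) \<Rightarrow> bool" where
  "ereal_convex \<phi> \<longleftrightarrow>
     (\<forall>x y. \<forall>t\<in>{0..1::real}.
        \<phi> ((1 - t) *\<^sub>R x + t *\<^sub>R y) \<le> ereal (1 - t) * \<phi> x + ereal t * \<phi> y)"

definition lower_semicont :: "('a::topological_space \<Rightarrow> ereal) \<Rightarrow> bool" where
  "lower_semicont \<phi> \<longleftrightarrow> (\<forall>x. \<phi> x \<le> Liminf (at x) \<phi>)"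

definition convex_conjugate :: "('a::real_inner \<Rightarrow> ereal) \<Rightarrow> 'a \<Rightarrow> ereal" where
  "convex_conjugate \<phi> y = (SUP x. ereal (x \<bullet> y) - \<phi> x)"

text \<open>As usual, the subdifferential is empty outside the effective domain.\<close>

definition subdifferential :: "('a::real_inner \<Rightarrow> ereal) \<Rightarrow> 'a \<Rightarrow> 'a set" where
  "subdifferential \<phi> x =
     {p. \<bar>\<phi> x\<bar> \<noteq> \<infinity> \<and> (\<forall>z. \<phi> x + ereal (p \<bullet> (z - x)) \<le> \<phi> z)}"

text \<open>
  The resolvent \<open>(id + \<gamma> \<partial>\<phi>)\<^sup>-\<^sup>1\<close>: the point \<open>u\<close> with \<open>x \<in> u + \<gamma> \<partial>\<phi>(u)\<close>. For proper convex lower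
  semicontinuous \<open>\<phi>\<close> and \<open>\<gamma> > 0\<close> this point exists and is unique.
\<close>

definition prox :: "real \<Rightarrow> ('a::real_inner \<Rightarrow> ereal) \<Rightarrow> 'a \<Rightarrow> 'a" where
  "prox \<gamma> \<phi> x = (THE u. x \<in> {u + \<gamma> *\<^sub>R p | p. p \<in> subdifferential \<phi> u})"

text \<open>The function \<open>exp (- t)\<close>, with \<open>exp (- \<infinity>) = 0\<close> and \<open>exp \<infinity> = \<infinity>\<close>.\<close>

definition exp_neg :: "ereal \<Rightarrow> ennreal" where
  "exp_neg t =
     (if t = \<infinity> then 0 else if t = -\<infinity> then \<infinity> else ennreal (exp (- real_of_ereal t)))"

section \<open>Transport distances\<close>

definition couplings :: "'a measure \<Rightarrow> 'b measure \<Rightarrow> ('a \<times> 'b) measure set" where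
  "couplings P Q =
     {G. prob_space G \<and> sets G = sets (P \<Otimes>\<^sub>M Q) \<and> distr G P fst = P \<and> distr G Q snd = Q}"

definition ennreal_sqrt :: "ennreal \<Rightarrow> ennreal" where
  "ennreal_sqrt t = (if t = \<infinity> then \<infinity> else ennreal (sqrt (enn2real t)))"

text \<open>
  Both distances are \<open>ennreal\<close>-valued, so that an infinite cost is \<open>\<infinity>\<close>; on laws with finite second
  moments they are finite.
\<close>

definition wasserstein2 :: "'a::euclidean_space measure \<Rightarrow> 'a measure \<Rightarrow> ennreal" where
  "wasserstein2 P Q =
     (INF G\<in>couplings P Q. ennreal_sqrt (\<integral>\<^sup>+ (x, x'). ennreal ((norm (x - x'))\<^sup>2) \<partial>G))"

definition transport_dist ::
    "real \<Rightarrow> real \<Rightarrow> ('a::euclidean_space \<times> 'b::euclidean_space) measure \<Rightarrow> ('a \<times> 'b) measure \<Rightarrow> ennreal"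
  where
  "transport_dist a b P Q =
     (INF G\<in>couplings P Q. ennreal_sqrt
        (\<integral>\<^sup>+ ((x, y), (x', y')). ennreal (a * (norm (x - x'))\<^sup>2 + b * (norm (y - y'))\<^sup>2) \<partial>G))"

section \<open>The primal-dual Langevin iteration\<close>

definition std_gaussian_density :: "real ^ 'd \<Rightarrow> real" where
  "std_gaussian_density x = exp (- (norm x)\<^sup>2 / 2) / (2 * pi) powr (real CARD('d) / 2)"

text \<open>
  The noise variables are \<open>\<xi> 1, \<xi> 2, \<dots>\<close>; the value \<open>\<xi> 0\<close> is not used. Mutual independence of the
  initial data \<open>Z0\<close> and the noise is stated through the generated sigma-algebras, indexed by 0 for
  the initial data and by \<open>n \<ge> 1\<close> for \<open>\<xi> n\<close>, because \<^const>\<open>prob_space.indep_vars\<close> needs all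
  variables to have the same type.
\<close>

definition gaussian_noise ::
    "'w measure \<Rightarrow> ('w \<Rightarrow> 'z::topological_space) \<Rightarrow> (nat \<Rightarrow> 'w \<Rightarrow> real ^ 'd) \<Rightarrow> bool" where
  "gaussian_noise M Z0 \<xi> \<longleftrightarrow>
     (\<forall>n. distributed M lborel (\<xi> (Suc n)) (\<lambda>x. ennreal (std_gaussian_density x))) \<and>
     prob_space.indep_sets M
       (case_nat (sets (vimage_algebra (space M) Z0 borel))
                 (\<lambda>n. sets (vimage_algebra (space M) (\<xi> (Suc n)) borel))) UNIV"

text \<open>For linear \<open>K\<close> the transpose \<open>K\<^sup>T\<close> is \<^term>\<open>adjoint K\<close>.\<close>

definition pd_langevin ::
    "'w measure \<Rightarrow> (real ^ 'd \<Rightarrow> real ^ 'm) \<Rightarrow> (real ^ 'm \<Rightarrow> ereal) \<Rightarrow> (real ^ 'd \<Rightarrow> ereal) \<Rightarrow>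
     real \<Rightarrow> real \<Rightarrow> real \<Rightarrow> (nat \<Rightarrow> 'w \<Rightarrow> real ^ 'd) \<Rightarrow>
     (nat \<Rightarrow> 'w \<Rightarrow> real ^ 'd) \<Rightarrow> (nat \<Rightarrow> 'w \<Rightarrow> real ^ 'm) \<Rightarrow> (nat \<Rightarrow> 'w \<Rightarrow> real ^ 'd) \<Rightarrow> bool" where
  "pd_langevin M K f g \<tau> \<sigma> \<theta> \<xi> X Y X\<theta> \<longleftrightarrow>
     (\<forall>\<omega>\<in>space M. X\<theta> 0 \<omega> = X 0 \<omega> \<and>
        (\<forall>n. Y (Suc n) \<omega> = prox \<sigma> (convex_conjugate f) (Y n \<omega> + \<sigma> *\<^sub>R K (X\<theta> n \<omega>)) \<and>
             X (Suc n) \<omega> = prox \<tau> g (X n \<omega> - \<tau> *\<^sub>R adjoint K (Y (Suc n) \<omega>))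
                             + sqrt (2 * \<tau>) *\<^sub>R \<xi> (Suc n) \<omega> \<and>
             X\<theta> (Suc n) \<omega> = X (Suc n) \<omega> + \<theta> *\<^sub>R (X (Suc n) \<omega> - X n \<omega>)))"

end

theory Submission
  imports Defs
begin

text \<open>
  Run both chains with the same noise. In the difference of the two trajectories the noise cancels, and
  what remains is the difference of two runs of a deterministic primal-dual splitting. The proximal maps
  are resolvents of monotone operators, hence firmly nonexpansive
  (\<open>firmly_nonexpansive_prox\<close>), and this drives the estimate. For the
  differences \<open>x\<^sub>n\<close>, \<open>y\<^sub>n\<close> and the increment \<open>d\<^sub>n = x\<^sub>n - x\<^sub>n\<^sub>-\<^sub>1\<close> (with \<open>d\<^sub>0 = 0\<close>) the energy
  \<open>\<parallel>x\<^sub>n\<parallel>\<^sup>2 / (2 \<tau>) + \<parallel>y\<^sub>n\<parallel>\<^sup>2 / (2 \<sigma>) + K d\<^sub>n \<bullet> y\<^sub>n + \<parallel>d\<^sub>n\<parallel>\<^sup>2 / (2 \<tau>)\<close>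
  does not increase when \<open>\<tau> \<sigma> \<parallel>K\<parallel>\<^sup>2 \<le> 1\<close> (\<open>pd_energy_step\<close>). Multiplied by
  \<open>2 \<tau>\<close>, it is initially the transport cost; later it dominates the primal part of the cost plus
  \<open>1 - \<tau> \<sigma> \<parallel>K\<parallel>\<^sup>2\<close> times the dual part (\<open>pd_energy_lower_bound\<close>). This gives a bound for every single pair of
  initial values and every noise sequence (\<open>pd_orbit_contraction\<close>).

  Two points need care. A proximal map is useful only if its defining inclusion is solvable at every
  point. Both functions are proper, since otherwise the target density would vanish identically. For \<open>g\<close>,
  solvability then follows by the direct method (\<open>resolvent_exists\<close>), and for the conjugate of \<open>f\<close> it follows
  from Moreau's identity (\<open>resolvent_exists_conjugate\<close>). Secondly, the initial values on the given
  probability space need not be optimally coupled. As the law of a chain depends only on its initial law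
  (\<open>pd_langevin_law\<close>), any coupling \<open>G\<close> of the initial laws can be used instead: on the product of \<open>G\<close> with
  the law of the noise, the two synchronous runs form a coupling of the laws after \<open>n\<close> steps, with a
  cost controlled by that of \<open>G\<close> (\<open>coupling_pushforward\<close>). The theorem is the infimum over \<open>G\<close>.
\<close>

section \<open>Resolvents of convex functions\<close>

definition ereal_proper :: "('a \<Rightarrow> ereal) \<Rightarrow> bool" where
  "ereal_proper \<phi> \<longleftrightarrow> (\<forall>x. \<phi> x \<noteq> -\<infinity>) \<and> (\<exists>x. \<phi> x \<noteq> \<infinity>)"

text \<open>
  Closed sublevel sets are the form of lower semicontinuity that the minimization below uses; the
  summand \<open>q\<close> will be the quadratic term of the proximal objective.
\<close>

lemma closed_sublevel_add_continuous:
  fixes \<phi> :: "'a::t2_space \<Rightarrow> ereal" and q :: "'a \<Rightarrow> real"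
  assumes lsc: "lower_semicont \<phi>" and q: "continuous_on UNIV q"
  shows "closed {u. \<phi> u + ereal (q u) \<le> ereal c}"
proof -
  have "open {u. ereal c < \<phi> u + ereal (q u)}"
  proof (subst open_subopen, intro ballI)
    fix x assume "x \<in> {u. ereal c < \<phi> u + ereal (q u)}"
    then have "ereal (c - q x) < \<phi> x"
      by (cases "\<phi> x") auto
    then obtain z where z: "ereal (c - q x) < ereal z" "ereal z < \<phi> x"
      using ereal_dense2 by blast
    have "eventually (\<lambda>u. ereal z < \<phi> u) (at x)"
      using lsc z(2) unfolding lower_semicont_def le_Liminf_iff by blast
    with z(2) have 1: "eventually (\<lambda>u. ereal z < \<phi> u) (nhds x)"
      by (simp add: eventually_nhds_conv_at)
    have "(q \<longlongrightarrow> q x) (nhds x)"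
      using q unfolding continuous_on_eq_continuous_at[OF open_UNIV] isCont_def
        tendsto_at_iff_tendsto_nhds by simp
    moreover have "c - z < q x" using z(1) by simp
    ultimately have 2: "eventually (\<lambda>u. c - z < q u) (nhds x)"
      by (rule order_tendstoD(1))
    have "eventually (\<lambda>u. ereal c < \<phi> u + ereal (q u)) (nhds x)"
      using 1 2
    proof eventually_elim
      case (elim u)
      then show ?case by (cases "\<phi> u") auto
    qed
    then show "\<exists>T. open T \<and> x \<in> T \<and> T \<subseteq> {u. ereal c < \<phi> u + ereal (q u)}"
      unfolding eventually_nhds by blast
  qed
  then show ?thesis
    unfolding closed_def by (simp add: Compl_eq not_le)
qed

text \<open>
  The sublevel sets above the infimum are closed and nested, so they have a common point in a compact
  set. No lower bound on \<open>h\<close> is presupposed: for a function that avoids \<open>-\<infinity>\<close>, the attained minimum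
  provides one.
\<close>

lemma attains_min_compact:
  fixes h :: "'a::topological_space \<Rightarrow> ereal"
  assumes sub: "\<And>c. closed {u. h u \<le> ereal c}" and S: "compact S" "S \<noteq> {}"
  shows "\<exists>u\<in>S. \<forall>z\<in>S. h u \<le> h z"
proof -
  define m where "m = (INF z\<in>S. h z)"
  have "S \<inter> (\<Inter>c\<in>{c. m < ereal c}. {u. h u \<le> ereal c}) \<noteq> {}"
  proof (rule compact_imp_fip_image[OF S(1) sub])
    fix I' :: "real set" assume I': "finite I'" "I' \<subseteq> {c. m < ereal c}"
    show "S \<inter> (\<Inter>c\<in>I'. {u. h u \<le> ereal c}) \<noteq> {}"
    proof (cases "I' = {}")
      case False
      then have "Min I' \<in> I'" using I' by simp
      then have "m < ereal (Min I')" using I'(2) by blast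
      then obtain z where "z \<in> S" "h z < ereal (Min I')"
        unfolding m_def INF_less_iff by blast
      moreover have "ereal (Min I') \<le> ereal c" if "c \<in> I'" for c
        using I'(1) that by simp
      ultimately show ?thesis by (force intro: order.strict_implies_order less_le_trans)
    qed (use S in auto)
  qed
  then obtain u where u: "u \<in> S" "\<And>c. m < ereal c \<Longrightarrow> h u \<le> ereal c" by blast
  have "h u \<le> m"
  proof (rule ccontr)
    assume "\<not> h u \<le> m"
    then obtain c where "m < ereal c" "ereal c < h u" using ereal_dense2 not_le by metis
    with u(2) show False by fastforce
  qed
  with u(1) show ?thesis unfolding m_def by (meson INF_lower order_trans)
qed

text \<open>
  A convex function decreases at most linearly in the distance to a point of its domain: on the unit
  ball it is bounded below by compactness, and a point \<open>z\<close> outside that ball is compared with the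
  boundary point on the segment from \<open>x0\<close> to \<open>z\<close>. This growth bound makes the quadratic term of the
  proximal objective win at infinity, and spares a separation argument for an affine minorant.
\<close>

lemma convex_lsc_radial_lower_bound:
  fixes \<phi> :: "'a::euclidean_space \<Rightarrow> ereal"
  assumes fin: "\<And>x. \<phi> x \<noteq> -\<infinity>" and cvx: "ereal_convex \<phi>" and lsc: "lower_semicont \<phi>"
    and r0: "\<phi> x0 = ereal r0"
  obtains b where "0 \<le> b" "\<And>z. ereal (- b - b * norm (z - x0)) \<le> \<phi> z"
proof -
  have "closed {u. \<phi> u \<le> ereal c}" for c
    using closed_sublevel_add_continuous[OF lsc, of "\<lambda>_. 0" c] by simp
  then obtain u where u: "\<forall>z\<in>cball x0 1. \<phi> u \<le> \<phi> z"
    using attains_min_compact[of \<phi> "cball x0 1"] by auto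
  have "\<phi> u \<le> ereal r0" using u r0 by (metis centre_in_cball zero_le_one)
  then obtain m where m: "\<phi> u = ereal m" using fin[of u] by (cases "\<phi> u") auto
  define b where "b = \<bar>m\<bar> + \<bar>r0\<bar>"
  have b0: "0 \<le> b" by (simp add: b_def)
  have "ereal (- b - b * norm (z - x0)) \<le> \<phi> z" for z
  proof (cases "norm (z - x0) \<le> 1")
    case True
    then have "ereal m \<le> \<phi> z" using u m by (auto simp: dist_norm norm_minus_commute)
    moreover have "- b - b * norm (z - x0) \<le> m"
      using mult_nonneg_nonneg[OF b0 norm_ge_zero[of "z - x0"]] unfolding b_def by linarith
    ultimately show ?thesis by (meson ereal_less_eq(3) order_trans)
  next
    case False
    define s where "s = norm (z - x0)"
    have s: "1 < s" using False by (simp add: s_def)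
    define w where "w = (1 - 1/s) *\<^sub>R x0 + (1/s) *\<^sub>R z"
    have "w - x0 = (1/s) *\<^sub>R (z - x0)" by (simp add: w_def algebra_simps)
    then have "norm (w - x0) = 1" using s by (simp flip: s_def)
    then have "ereal m \<le> \<phi> w" using u m by (auto simp: dist_norm norm_minus_commute)
    also have "\<phi> w \<le> ereal (1 - 1/s) * \<phi> x0 + ereal (1/s) * \<phi> z"
    proof -
      have "1/s \<in> {0..1}" using s by simp
      then show ?thesis using cvx unfolding ereal_convex_def w_def by blast
    qed
    finally have *: "ereal m \<le> ereal (1 - 1/s) * \<phi> x0 + ereal (1/s) * \<phi> z" .
    show ?thesis
    proof (cases "\<phi> z")
      case (real v)
      have "m \<le> (1 - 1/s) * r0 + (1/s) * v" using * by (simp add: r0 real)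
      then have "s * m \<le> s * ((1 - 1/s) * r0 + (1/s) * v)" using s by simp
      also have "\<dots> = (s - 1) * r0 + v" using s by (simp add: field_simps)
      finally have "s * m - (s - 1) * r0 \<le> v" by simp
      moreover have "s * (- \<bar>m\<bar>) \<le> s * m" using s by (intro mult_left_mono) auto
      moreover have "(s - 1) * r0 \<le> (s - 1) * \<bar>r0\<bar>" using s by (intro mult_left_mono) auto
      moreover have "(s - 1) * \<bar>r0\<bar> \<le> s * \<bar>r0\<bar>" by (intro mult_right_mono) auto
      moreover have "b * s = s * \<bar>m\<bar> + s * \<bar>r0\<bar>" by (simp add: b_def algebra_simps)
      ultimately have "- b - b * s \<le> v" using b0 by linarith
      then show ?thesis by (simp add: real s_def)
    qed (use fin in auto)
  qed
  with b0 show ?thesis by (rule that)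
qed

text \<open>
  The point \<open>u\<close> is the minimizer of \<open>\<phi> u + \<parallel>u - x\<parallel>\<^sup>2 / (2 \<gamma>)\<close>. A minimizer exists on a large ball by
  compactness, and outside the ball the objective exceeds its value at \<open>x0\<close>. To see that
  \<open>(x - u) / \<gamma>\<close> is a subgradient at \<open>u\<close>, compare \<open>u\<close> with the points of the segment from \<open>u\<close> to \<open>z\<close>: by
  convexity the subgradient inequality holds up to an error proportional to the segment parameter,
  which then tends to 0.
\<close>

lemma resolvent_exists:
  fixes \<phi> :: "'a::euclidean_space \<Rightarrow> ereal"
  assumes pr: "ereal_proper \<phi>" and cvx: "ereal_convex \<phi>" and lsc: "lower_semicont \<phi>" and \<gamma>: "\<gamma> > 0"
  shows "\<exists>u. \<exists>p\<in>subdifferential \<phi> u. x = u + \<gamma> *\<^sub>R p"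
proof -
  have fin: "\<phi> z \<noteq> -\<infinity>" for z using pr by (simp add: ereal_proper_def)
  obtain x0 r0 where r0: "\<phi> x0 = ereal r0"
    using pr unfolding ereal_proper_def by (metis ereal_cases)
  obtain b where b: "0 \<le> b" "\<And>z. ereal (- b - b * norm (z - x0)) \<le> \<phi> z"
    using convex_lsc_radial_lower_bound[OF fin cvx lsc r0] by blast
  define q where "q u = (norm (u - x))\<^sup>2 / (2 * \<gamma>)" for u
  define h where "h u = \<phi> u + ereal (q u)" for u
  define A where "A = b + b * norm (x - x0) + \<bar>r0 + q x0\<bar>"
  \<comment> \<open>The radius is such that, for \<open>s > R\<close>, the quadratic \<open>s\<^sup>2 / (2 \<gamma>)\<close> dominates \<open>A + b s\<close>, which
    bounds the loss allowed by the radial lower bound plus the value of the objective at \<open>x0\<close>.\<close>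
  define R where "R = 1 + norm (x - x0) + 2 * \<gamma> * (A + b)"
  have A0: "0 \<le> A" using b(1) by (simp add: A_def)
  have R1: "R \<ge> 1" using A0 b(1) \<gamma> by (simp add: R_def)
  \<comment> \<open>Since \<open>x0\<close> lies in the ball, the minimum over the ball is also below every outside value.\<close>
  have x0R: "x0 \<in> cball x R"
    using A0 b(1) \<gamma> by (simp add: R_def dist_norm)
  have "continuous_on UNIV q" unfolding q_def by (intro continuous_intros) (use \<gamma> in auto)
  then have sub: "closed {u. h u \<le> ereal c}" for c
    unfolding h_def by (rule closed_sublevel_add_continuous[OF lsc])
  have "cball x R \<noteq> {}" using x0R by blast
  with attains_min_compact[OF sub compact_cball]
  obtain u where uR: "\<forall>z\<in>cball x R. h u \<le> h z" by blast
  have hu0: "h u \<le> ereal (r0 + q x0)" using uR x0R r0 by (force simp: h_def)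
  have u: "h u \<le> h z" for z
  proof (cases "z \<in> cball x R")
    case False
    define s where "s = norm (z - x)"
    have s: "R < s" using False by (simp add: s_def dist_norm norm_minus_commute)
    have "norm (z - x0) \<le> s + norm (x - x0)"
      unfolding s_def by (rule order_trans[OF _ norm_triangle_ineq]) simp
    then have "b * norm (z - x0) \<le> b * s + b * norm (x - x0)"
      using b(1) by (metis mult_left_mono distrib_left)
    then have 1: "- b - b * s - b * norm (x - x0) \<le> - b - b * norm (z - x0)" by simp
    have "(A + b) * (2 * \<gamma>) \<le> s" using s by (simp add: R_def algebra_simps) (smt (verit) norm_ge_zero)
    then have "A + b \<le> s / (2 * \<gamma>)" using \<gamma> by (simp add: pos_le_divide_eq)
    then have "s * (A + b) \<le> s * (s / (2 * \<gamma>))" using s R1 by (intro mult_left_mono) auto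
    also have "\<dots> = q z" by (simp add: q_def s_def power2_eq_square)
    finally have "s * A + s * b \<le> q z" by (simp add: algebra_simps)
    moreover have "1 * A \<le> s * A" using s R1 A0 by (intro mult_right_mono) auto
    ultimately have "A + b * s \<le> q z" by (simp add: mult.commute)
    then have "r0 + q x0 \<le> - b - b * norm (z - x0) + q z"
      using 1 unfolding A_def by linarith
    then have "ereal (r0 + q x0) \<le> ereal (- b - b * norm (z - x0)) + ereal (q z)" by simp
    also have "\<dots> \<le> h z" unfolding h_def using b(2) by (intro add_right_mono)
    finally show ?thesis using hu0 by (rule order_trans[rotated])
  qed (use uR in blast)
  obtain a where a: "\<phi> u = ereal a"
    using hu0 fin[of u] by (cases "\<phi> u") (auto simp: h_def)
  define p where "p = (1 / \<gamma>) *\<^sub>R (x - u)"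
  have "\<phi> u + ereal (p \<bullet> (z - u)) \<le> \<phi> z" for z
  proof (cases "\<phi> z")
    case (real v)
    define e where "e = (norm (z - u))\<^sup>2 / (2 * \<gamma>)"
    have step: "a + p \<bullet> (z - u) \<le> v + t * e" if t: "0 < t" "t \<le> 1" for t
    proof -
      define w where "w = (1 - t) *\<^sub>R u + t *\<^sub>R z"
      have "\<phi> w \<le> ereal (1 - t) * \<phi> u + ereal t * \<phi> z"
        using cvx t unfolding ereal_convex_def w_def by auto
      then have "\<phi> w \<le> ereal ((1 - t) * a + t * v)" by (simp add: a real)
      then have "h w \<le> ereal ((1 - t) * a + t * v) + ereal (q w)"
        unfolding h_def by (rule add_right_mono)
      with u[of w] have "h u \<le> ereal ((1 - t) * a + t * v) + ereal (q w)"
        by (rule order_trans)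
      then have 1: "a + q u \<le> (1 - t) * a + t * v + q w" by (simp add: h_def a)
      have "w - x = (u - x) + t *\<^sub>R (z - u)" by (simp add: w_def algebra_simps)
      then have "(norm (w - x))\<^sup>2 = (norm (u - x))\<^sup>2 + 2 * t * ((u - x) \<bullet> (z - u)) + t\<^sup>2 * (norm (z - u))\<^sup>2"
        by (simp only: power2_norm_eq_inner)
           (simp add: inner_add_left inner_add_right inner_commute power2_eq_square)
      then have "q w = q u + t * ((u - x) \<bullet> (z - u)) / \<gamma> + t\<^sup>2 * e"
        using \<gamma> by (simp add: q_def e_def field_simps)
      moreover have "(u - x) \<bullet> (z - u) / \<gamma> = - (p \<bullet> (z - u))"
        by (simp add: p_def inner_diff_left diff_divide_distrib)
      ultimately have "q w = q u - t * (p \<bullet> (z - u)) + t\<^sup>2 * e"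
        by (metis (no_types, lifting) add_uminus_conv_diff mult_minus_right times_divide_eq_right)
      with 1 have "t * (a + p \<bullet> (z - u)) \<le> t * (v + t * e)"
        by (simp add: algebra_simps power2_eq_square)
      then show ?thesis using t by simp
    qed
    have "((\<lambda>t. v + t * e) \<longlongrightarrow> v + 0 * e) (at_right 0)"
      by (intro tendsto_intros)
    moreover have "eventually (\<lambda>t. a + p \<bullet> (z - u) \<le> v + t * e) (at_right 0)"
      using eventually_at_right_real[OF zero_less_one] by eventually_elim (use step in auto)
    ultimately have "a + p \<bullet> (z - u) \<le> v + 0 * e"
      by (rule tendsto_lowerbound) simp
    then show ?thesis by (simp add: a real)
  qed (use fin in auto)
  then have "p \<in> subdifferential \<phi> u" by (simp add: subdifferential_def a)
  moreover have "x = u + \<gamma> *\<^sub>R p" using \<gamma> by (simp add: p_def)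
  ultimately show ?thesis by blast
qed

lemma subdifferential_monotone:
  assumes p: "p \<in> subdifferential \<phi> u" and q: "q \<in> subdifferential \<phi> v"
  shows "0 \<le> (p - q) \<bullet> (u - v)"
proof -
  obtain a where a: "\<phi> u = ereal a" using p by (cases "\<phi> u") (auto simp: subdifferential_def)
  obtain b where b: "\<phi> v = ereal b" using q by (cases "\<phi> v") (auto simp: subdifferential_def)
  have "a + p \<bullet> (v - u) \<le> b" using p a b by (auto simp: subdifferential_def dest: spec[of _ v])
  moreover have "b + q \<bullet> (u - v) \<le> a" using q a b by (auto simp: subdifferential_def dest: spec[of _ u])
  ultimately show ?thesis by (simp add: inner_diff_left inner_diff_right)
qed

text \<open>
  The easy half of Fenchel duality: a subgradient attains equality in the Fenchel-Young inequality.
\<close>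

lemma subdifferential_convex_conjugate:
  fixes \<phi> :: "'a::real_inner \<Rightarrow> ereal"
  assumes p: "p \<in> subdifferential \<phi> u"
  shows "u \<in> subdifferential (convex_conjugate \<phi>) p"
proof -
  obtain a where a: "\<phi> u = ereal a" using p by (cases "\<phi> u") (auto simp: subdifferential_def)
  have le: "ereal a + ereal (p \<bullet> (z - u)) \<le> \<phi> z" for z
    using p a by (auto simp: subdifferential_def)
  have lower: "ereal (u \<bullet> y - a) \<le> convex_conjugate \<phi> y" for y
    unfolding convex_conjugate_def by (rule SUP_upper2[of u]) (simp_all add: a)
  have "convex_conjugate \<phi> p \<le> ereal (u \<bullet> p - a)"
    unfolding convex_conjugate_def
  proof (rule SUP_least)
    fix z show "ereal (z \<bullet> p) - \<phi> z \<le> ereal (u \<bullet> p - a)"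
      using le[of z] by (cases "\<phi> z") (auto simp: inner_diff_right inner_commute)
  qed
  with lower[of p] have eq: "convex_conjugate \<phi> p = ereal (u \<bullet> p - a)" by (rule antisym[rotated])
  have "ereal (u \<bullet> p - a + u \<bullet> (y - p)) \<le> convex_conjugate \<phi> y" for y
    using lower[of y] by (simp add: inner_diff_right)
  then show ?thesis by (simp add: subdifferential_def eq)
qed

text \<open>
  Moreau's identity: the resolvent of the conjugate at \<open>y\<close> is read off from the resolvent of \<open>\<phi>\<close> with
  step \<open>1 / \<sigma>\<close> at \<open>y / \<sigma>\<close>. This avoids showing that the conjugate is itself proper, convex and lower
  semicontinuous.
\<close>

lemma resolvent_exists_conjugate:
  fixes \<phi> :: "'a::euclidean_space \<Rightarrow> ereal"
  assumes "ereal_proper \<phi>" "ereal_convex \<phi>" "lower_semicont \<phi>" and \<sigma>: "\<sigma> > 0"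
  shows "\<exists>u. \<exists>p\<in>subdifferential (convex_conjugate \<phi>) u. y = u + \<sigma> *\<^sub>R p"
proof -
  obtain v p where p: "p \<in> subdifferential \<phi> v" and y: "(1 / \<sigma>) *\<^sub>R y = v + (1 / \<sigma>) *\<^sub>R p"
    using resolvent_exists[OF assms(1-3), of "1 / \<sigma>" "(1 / \<sigma>) *\<^sub>R y"] \<sigma> by auto
  have "y = \<sigma> *\<^sub>R ((1 / \<sigma>) *\<^sub>R y)" using \<sigma> by simp
  also have "\<dots> = p + \<sigma> *\<^sub>R v" using \<sigma> unfolding y by (simp add: scaleR_add_right)
  finally show ?thesis using subdifferential_convex_conjugate[OF p] by blast
qed

text \<open>
  Stated as monotonicity of the residual, which is the inequality that the energy estimate consumes.
\<close>

definition firmly_nonexpansive :: "('a::real_inner \<Rightarrow> 'a) \<Rightarrow> bool" where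
  "firmly_nonexpansive T \<longleftrightarrow> (\<forall>x x'. 0 \<le> ((x - T x) - (x' - T x')) \<bullet> (T x - T x'))"

text \<open>
  Monotonicity of the subdifferential gives uniqueness of the resolvent point as well as the estimate;
  existence makes the definite description in the proximal map meaningful at every point.
\<close>

lemma firmly_nonexpansive_prox:
  assumes ex: "\<And>x. \<exists>u. \<exists>p\<in>subdifferential \<phi> u. x = u + \<gamma> *\<^sub>R p" and \<gamma>: "\<gamma> > 0"
  shows "firmly_nonexpansive (prox \<gamma> \<phi>)"
proof -
  have mono: "0 \<le> ((x - u) - (x' - u')) \<bullet> (u - u')"
    if x_in: "x \<in> {u + \<gamma> *\<^sub>R p | p. p \<in> subdifferential \<phi> u}"
      and x'_in: "x' \<in> {u' + \<gamma> *\<^sub>R p | p. p \<in> subdifferential \<phi> u'}" for x x' u u'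
  proof -
    obtain p p' where p: "p \<in> subdifferential \<phi> u" "p' \<in> subdifferential \<phi> u'"
      and x: "x = u + \<gamma> *\<^sub>R p" "x' = u' + \<gamma> *\<^sub>R p'" using x_in x'_in by blast
    have "(x - u) - (x' - u') = \<gamma> *\<^sub>R (p - p')" by (simp add: x scaleR_diff_right)
    then show ?thesis using subdifferential_monotone[OF p] \<gamma> by simp
  qed
  have "\<exists>!u. x \<in> {u + \<gamma> *\<^sub>R p | p. p \<in> subdifferential \<phi> u}" for x
  proof (rule ex_ex1I)
    show "\<exists>u. x \<in> {u + \<gamma> *\<^sub>R p | p. p \<in> subdifferential \<phi> u}" using ex[of x] by blast
    fix u v
    assume "x \<in> {u + \<gamma> *\<^sub>R p | p. p \<in> subdifferential \<phi> u}"
      "x \<in> {v + \<gamma> *\<^sub>R p | p. p \<in> subdifferential \<phi> v}"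
    from mono[OF this] have "0 \<le> - ((u - v) \<bullet> (u - v))"
      by (simp add: inner_diff_left inner_diff_right)
    then show "u = v" by (metis eq_iff_diff_eq_0 inner_gt_zero_iff neg_0_le_iff_le not_le)
  qed
  from theI'[OF this] show ?thesis
    unfolding firmly_nonexpansive_def prox_def[symmetric] by (intro allI mono)
qed

lemma firmly_nonexpansive_continuous:
  fixes T :: "'a::real_inner \<Rightarrow> 'a"
  assumes "firmly_nonexpansive T"
  shows "continuous_on UNIV T"
proof -
  have "norm (T x - T x') \<le> norm (x - x')" for x x'
  proof -
    have "(norm (T x - T x'))\<^sup>2 \<le> (x - x') \<bullet> (T x - T x')"
      using assms[unfolded firmly_nonexpansive_def, rule_format, of x x']
      by (simp add: power2_norm_eq_inner inner_diff_left inner_diff_right)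
    also have "\<dots> \<le> norm (x - x') * norm (T x - T x')" by (rule norm_cauchy_schwarz)
    finally show ?thesis
      by (cases "T x = T x'") (auto simp: power2_eq_square)
  qed
  then have "1-lipschitz_on UNIV T" by (auto simp: lipschitz_on_def dist_norm)
  then show ?thesis by (rule lipschitz_on_continuous_on)
qed

section \<open>Energy decay for synchronous trajectories\<close>

text \<open>
  One trajectory with relaxation parameter 1, for a fixed noise sequence \<open>w\<close> and arbitrary maps \<open>R\<close> and
  \<open>S\<close> in place of the two proximal maps. Entry \<open>n\<close> of \<open>w\<close> drives the step from \<open>n\<close> to \<open>n + 1\<close>; the third
  component is the over-relaxed primal variable.
\<close>

primrec pd_orbit ::
  "real \<Rightarrow> real \<Rightarrow> ('a::euclidean_space \<Rightarrow> 'b::euclidean_space) \<Rightarrow> ('b \<Rightarrow> 'b) \<Rightarrow> ('a \<Rightarrow> 'a) \<Rightarrow>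
   (nat \<Rightarrow> 'a) \<Rightarrow> 'a \<times> 'b \<Rightarrow> nat \<Rightarrow> 'a \<times> 'b \<times> 'a" where
  "pd_orbit \<tau> \<sigma> K R S w z 0 = (fst z, snd z, fst z)"
| "pd_orbit \<tau> \<sigma> K R S w z (Suc n) =
     (let s = pd_orbit \<tau> \<sigma> K R S w z n;
          x = fst s; y = fst (snd s); x\<theta> = snd (snd s);
          y' = R (y + \<sigma> *\<^sub>R K x\<theta>);
          x' = S (x - \<tau> *\<^sub>R adjoint K y') + sqrt (2 * \<tau>) *\<^sub>R w n
      in (x', y', x' + (x' - x)))"

definition pd_iterate ::
  "real \<Rightarrow> real \<Rightarrow> ('a::euclidean_space \<Rightarrow> 'b::euclidean_space) \<Rightarrow> ('b \<Rightarrow> 'b) \<Rightarrow> ('a \<Rightarrow> 'a) \<Rightarrow>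
   nat \<Rightarrow> (nat \<Rightarrow> 'a) \<Rightarrow> 'a \<times> 'b \<Rightarrow> 'a \<times> 'b" where
  "pd_iterate \<tau> \<sigma> K R S n w z = (let s = pd_orbit \<tau> \<sigma> K R S w z n in (fst s, fst (snd s)))"

text \<open>
  The Lyapunov function for the difference of two trajectories: \<open>x\<close> and \<open>y\<close> are the current primal and
  dual differences, and \<open>d\<close> is the last increment of the primal difference. The term \<open>K d \<bullet> y\<close>, which
  can be negative, is what makes the energy telescope.
\<close>

definition pd_energy ::
  "real \<Rightarrow> real \<Rightarrow> ('a::euclidean_space \<Rightarrow> 'b::euclidean_space) \<Rightarrow> 'a \<Rightarrow> 'b \<Rightarrow> 'a \<Rightarrow> real" where
  "pd_energy \<tau> \<sigma> K x y d =
     (norm x)\<^sup>2 / (2 * \<tau>) + (norm y)\<^sup>2 / (2 * \<sigma>) + K d \<bullet> y + (norm d)\<^sup>2 / (2 * \<tau>)"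

text \<open>
  The weights are the ones for which the first term is exactly the increment term of the energy.
\<close>

lemma bilinear_weighted_young:
  fixes K :: "'a::euclidean_space \<Rightarrow> 'b::euclidean_space"
  assumes K: "linear K" and \<tau>: "\<tau> > 0"
  shows "\<bar>K d \<bullet> v\<bar> \<le> (norm d)\<^sup>2 / (2 * \<tau>) + \<tau> * (onorm K)\<^sup>2 * (norm v)\<^sup>2 / 2"
proof -
  have "\<bar>K d \<bullet> v\<bar> \<le> norm (K d) * norm v" by (rule Cauchy_Schwarz_ineq2)
  also have "\<dots> \<le> (onorm K * norm d) * norm v"
    using K by (intro mult_right_mono onorm) (auto simp: linear_conv_bounded_linear)
  also have "\<dots> \<le> (norm d)\<^sup>2 / (2 * \<tau>) + \<tau> * (onorm K)\<^sup>2 * (norm v)\<^sup>2 / 2"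
  proof -
    have "0 \<le> (norm d - \<tau> * (onorm K * norm v))\<^sup>2 / (2 * \<tau>)" using \<tau> by simp
    also have "\<dots> = (norm d)\<^sup>2 / (2 * \<tau>) - (onorm K * norm d) * norm v
        + \<tau> * (onorm K)\<^sup>2 * (norm v)\<^sup>2 / 2"
      using \<tau> by (simp add: power2_eq_square field_simps)
    finally show ?thesis by simp
  qed
  finally show ?thesis .
qed

text \<open>
  Divide the dual inequality by \<open>\<sigma>\<close> and the primal one by \<open>\<tau>\<close> and add. By polarization, the quadratic
  terms telescope up to the gains \<open>\<parallel>y - y'\<parallel>\<^sup>2 / (2 \<sigma>)\<close> and \<open>\<parallel>x - x'\<parallel>\<^sup>2 / (2 \<tau>)\<close>. In the coupling terms the
  extrapolated \<open>x + d\<close> replaces the unknown \<open>x'\<close>, which leaves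
  \<open>K (x + d - x') \<bullet> y' = K d \<bullet> y - K (x' - x) \<bullet> y' + K d \<bullet> (y' - y)\<close>. The first two terms telescope, and
  the last one is absorbed by the dual gain together with the increment term of the previous energy;
  this is where \<open>\<tau> \<sigma> \<parallel>K\<parallel>\<^sup>2 \<le> 1\<close> enters. The primal gain becomes the increment term of the new energy.
\<close>

lemma pd_energy_step:
  fixes K :: "'a::euclidean_space \<Rightarrow> 'b::euclidean_space"
  assumes K: "linear K" and \<tau>: "\<tau> > 0" and \<sigma>: "\<sigma> > 0" and small: "\<tau> * \<sigma> * (onorm K)\<^sup>2 \<le> 1"
    and dual: "0 \<le> (y + \<sigma> *\<^sub>R K (x + d) - y') \<bullet> y'"
    and primal: "0 \<le> (x - \<tau> *\<^sub>R adjoint K y' - x') \<bullet> x'"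
  shows "pd_energy \<tau> \<sigma> K x' y' (x' - x) \<le> pd_energy \<tau> \<sigma> K x y d"
proof -
  interpret K: linear K by (rule K)
  have adj: "adjoint K y' \<bullet> x' = K x' \<bullet> y'"
    using adjoint_works[OF K, of x' y'] by (simp add: inner_commute)
  have polar: "u \<bullet> v = ((norm u)\<^sup>2 + (norm v)\<^sup>2 - (norm (u - v))\<^sup>2) / 2" for u v :: "'c::real_inner"
    by (simp add: power2_norm_eq_inner inner_diff_left inner_diff_right inner_commute)
  have "0 \<le> y \<bullet> y' - y' \<bullet> y' + \<sigma> * (K (x + d) \<bullet> y')"
    using dual by (simp add: inner_diff_left inner_add_left)
  then have "0 \<le> ((norm y)\<^sup>2 - (norm y')\<^sup>2 - (norm (y - y'))\<^sup>2) / 2 + \<sigma> * (K (x + d) \<bullet> y')"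
    by (simp add: polar[of y y'] power2_norm_eq_inner[symmetric] field_simps)
  then have "0 \<le> (((norm y)\<^sup>2 - (norm y')\<^sup>2 - (norm (y - y'))\<^sup>2) / 2 + \<sigma> * (K (x + d) \<bullet> y')) / \<sigma>"
    using \<sigma> by simp
  also have "\<dots> = (norm y)\<^sup>2 / (2 * \<sigma>) - (norm y')\<^sup>2 / (2 * \<sigma>) - (norm (y - y'))\<^sup>2 / (2 * \<sigma>)
      + K (x + d) \<bullet> y'"
    using \<sigma> by (simp add: field_simps)
  finally have D: "0 \<le> \<dots>" .
  have "0 \<le> x \<bullet> x' - x' \<bullet> x' - \<tau> * (K x' \<bullet> y')"
    using primal adj by (simp add: inner_diff_left)
  then have "0 \<le> ((norm x)\<^sup>2 - (norm x')\<^sup>2 - (norm (x - x'))\<^sup>2) / 2 - \<tau> * (K x' \<bullet> y')"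
    by (simp add: polar[of x x'] power2_norm_eq_inner[symmetric] field_simps)
  then have "0 \<le> (((norm x)\<^sup>2 - (norm x')\<^sup>2 - (norm (x - x'))\<^sup>2) / 2 - \<tau> * (K x' \<bullet> y')) / \<tau>"
    using \<tau> by simp
  also have "\<dots> = (norm x)\<^sup>2 / (2 * \<tau>) - (norm x')\<^sup>2 / (2 * \<tau>) - (norm (x - x'))\<^sup>2 / (2 * \<tau>)
      - K x' \<bullet> y'"
    using \<tau> by (simp add: field_simps)
  finally have P: "0 \<le> \<dots>" .
  have "\<tau> * (onorm K)\<^sup>2 / 2 \<le> 1 / (2 * \<sigma>)"
    using small \<sigma> by (simp add: field_simps)
  then have "\<tau> * (onorm K)\<^sup>2 / 2 * (norm (y' - y))\<^sup>2 \<le> 1 / (2 * \<sigma>) * (norm (y' - y))\<^sup>2"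
    by (rule mult_right_mono) simp
  then have "\<bar>K d \<bullet> (y' - y)\<bar> \<le> (norm d)\<^sup>2 / (2 * \<tau>) + (norm (y - y'))\<^sup>2 / (2 * \<sigma>)"
    using bilinear_weighted_young[OF K \<tau>, of d "y' - y"] by (simp add: norm_minus_commute)
  then have Y: "K d \<bullet> y' - K d \<bullet> y \<le> (norm d)\<^sup>2 / (2 * \<tau>) + (norm (y - y'))\<^sup>2 / (2 * \<sigma>)"
    by (simp add: inner_diff_right)
  have "K (x + d) \<bullet> y' = K x \<bullet> y' + K d \<bullet> y'" "K (x' - x) \<bullet> y' = K x' \<bullet> y' - K x \<bullet> y'"
    by (simp_all add: K.add K.diff inner_add_left inner_diff_left)
  with D P Y show ?thesis
    unfolding pd_energy_def norm_minus_commute[of x' x] by linarith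
qed

text \<open>
  Spending the whole increment term on the coupling term leaves the full primal distance and the
  fraction \<open>1 - \<tau> \<sigma> \<parallel>K\<parallel>\<^sup>2\<close> of the dual distance.
\<close>

lemma pd_energy_lower_bound:
  fixes K :: "'a::euclidean_space \<Rightarrow> 'b::euclidean_space"
  assumes K: "linear K" and \<tau>: "\<tau> > 0" and \<sigma>: "\<sigma> > 0"
  shows "(norm x)\<^sup>2 + (1 - \<tau> * \<sigma> * (onorm K)\<^sup>2) * (\<tau> / \<sigma> * (norm y)\<^sup>2) \<le> 2 * \<tau> * pd_energy \<tau> \<sigma> K x y d"
proof -
  have "- (K d \<bullet> y) \<le> (norm d)\<^sup>2 / (2 * \<tau>) + \<tau> * (onorm K)\<^sup>2 * (norm y)\<^sup>2 / 2"
    using bilinear_weighted_young[OF K \<tau>, of d y] by linarith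
  then have "(norm x)\<^sup>2 / (2 * \<tau>) + (norm y)\<^sup>2 / (2 * \<sigma>) - \<tau> * (onorm K)\<^sup>2 * (norm y)\<^sup>2 / 2
      \<le> pd_energy \<tau> \<sigma> K x y d"
    unfolding pd_energy_def by linarith
  then have "2 * \<tau> * ((norm x)\<^sup>2 / (2 * \<tau>) + (norm y)\<^sup>2 / (2 * \<sigma>) - \<tau> * (onorm K)\<^sup>2 * (norm y)\<^sup>2 / 2)
      \<le> 2 * \<tau> * pd_energy \<tau> \<sigma> K x y d"
    using \<tau> by (intro mult_left_mono) auto
  moreover have "2 * \<tau> * ((norm x)\<^sup>2 / (2 * \<tau>) + (norm y)\<^sup>2 / (2 * \<sigma>) - \<tau> * (onorm K)\<^sup>2 * (norm y)\<^sup>2 / 2)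
      = (norm x)\<^sup>2 + (1 - \<tau> * \<sigma> * (onorm K)\<^sup>2) * (\<tau> / \<sigma> * (norm y)\<^sup>2)"
    using \<tau> \<sigma> by (simp add: field_simps)
  ultimately show ?thesis by simp
qed

text \<open>
  Both trajectories use the same \<open>w\<close>, so the noise cancels in every difference and only firm
  nonexpansiveness of the two maps is left. Initially the increment term vanishes, because the
  over-relaxed variable starts at the primal one.
\<close>

lemma pd_orbit_contraction:
  fixes K :: "'a::euclidean_space \<Rightarrow> 'b::euclidean_space"
  assumes K: "linear K" and \<tau>: "\<tau> > 0" and \<sigma>: "\<sigma> > 0" and small: "\<tau> * \<sigma> * (onorm K)\<^sup>2 \<le> 1"
    and R: "firmly_nonexpansive R" and S: "firmly_nonexpansive S"
    and u: "u = pd_iterate \<tau> \<sigma> K R S n w z" and v: "v = pd_iterate \<tau> \<sigma> K R S n w z'"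
  shows "(norm (fst u - fst v))\<^sup>2 + (1 - \<tau> * \<sigma> * (onorm K)\<^sup>2) * (\<tau> / \<sigma> * (norm (snd u - snd v))\<^sup>2)
           \<le> (norm (fst z - fst z'))\<^sup>2 + \<tau> / \<sigma> * (norm (snd z - snd z'))\<^sup>2"
proof -
  interpret K: linear K by (rule K)
  define s where "s = pd_orbit \<tau> \<sigma> K R S w z"
  define t where "t = pd_orbit \<tau> \<sigma> K R S w z'"
  define x where "x k = fst (s k) - fst (t k)" for k
  define y where "y k = fst (snd (s k)) - fst (snd (t k))" for k
  define d where "d k = snd (snd (s k)) - snd (snd (t k)) - x k" for k
  have step: "pd_energy \<tau> \<sigma> K (x (Suc k)) (y (Suc k)) (d (Suc k)) \<le> pd_energy \<tau> \<sigma> K (x k) (y k) (d k)" for k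
  proof -
    have "d (Suc k) = x (Suc k) - x k"
      by (simp add: d_def x_def s_def t_def Let_def)
    moreover have "0 \<le> (y k + \<sigma> *\<^sub>R K (x k + d k) - y (Suc k)) \<bullet> y (Suc k)"
      using R[unfolded firmly_nonexpansive_def, rule_format,
          of "fst (snd (s k)) + \<sigma> *\<^sub>R K (snd (snd (s k)))" "fst (snd (t k)) + \<sigma> *\<^sub>R K (snd (snd (t k)))"]
      by (simp add: d_def y_def s_def t_def Let_def K.diff scaleR_diff_right algebra_simps)
    moreover have "0 \<le> (x k - \<tau> *\<^sub>R adjoint K (y (Suc k)) - x (Suc k)) \<bullet> x (Suc k)"
    proof -
      define a where "a = fst (snd (s (Suc k)))"
      define b where "b = fst (snd (t (Suc k)))"
      define p where "p = S (fst (s k) - \<tau> *\<^sub>R adjoint K a)"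
      define q where "q = S (fst (t k) - \<tau> *\<^sub>R adjoint K b)"
      have "adjoint K (y (Suc k)) = adjoint K a - adjoint K b"
        using linear_diff[OF adjoint_linear[OF K]] by (simp add: y_def a_def b_def)
      moreover have "x (Suc k) = p - q"
        by (simp add: x_def s_def t_def p_def q_def a_def b_def Let_def)
      moreover have "0 \<le> ((fst (s k) - \<tau> *\<^sub>R adjoint K a - p) - (fst (t k) - \<tau> *\<^sub>R adjoint K b - q)) \<bullet> (p - q)"
        using S unfolding firmly_nonexpansive_def p_def q_def by blast
      moreover have "(fst (s k) - \<tau> *\<^sub>R adjoint K a - p) - (fst (t k) - \<tau> *\<^sub>R adjoint K b - q)
          = x k - \<tau> *\<^sub>R (adjoint K a - adjoint K b) - (p - q)"
        by (simp add: x_def algebra_simps)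
      ultimately show ?thesis by simp
    qed
    ultimately show ?thesis using pd_energy_step[OF K \<tau> \<sigma> small] by simp
  qed
  have "pd_energy \<tau> \<sigma> K (x n) (y n) (d n) \<le> pd_energy \<tau> \<sigma> K (x 0) (y 0) (d 0)"
    by (induction n) (use step order_trans in blast)+
  moreover have "d 0 = 0" by (simp add: d_def x_def s_def t_def)
  ultimately have "2 * \<tau> * pd_energy \<tau> \<sigma> K (x n) (y n) (d n)
      \<le> 2 * \<tau> * ((norm (x 0))\<^sup>2 / (2 * \<tau>) + (norm (y 0))\<^sup>2 / (2 * \<sigma>))"
    using \<tau> by (simp add: pd_energy_def K.zero)
  also have "\<dots> = (norm (x 0))\<^sup>2 + \<tau> / \<sigma> * (norm (y 0))\<^sup>2"
    using \<tau> \<sigma> by (simp add: field_simps)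
  finally have "(norm (x n))\<^sup>2 + (1 - \<tau> * \<sigma> * (onorm K)\<^sup>2) * (\<tau> / \<sigma> * (norm (y n))\<^sup>2)
      \<le> (norm (x 0))\<^sup>2 + \<tau> / \<sigma> * (norm (y 0))\<^sup>2"
    using pd_energy_lower_bound[OF K \<tau> \<sigma>, of "x n" "y n" "d n"] by linarith
  then show ?thesis
    by (simp add: u v pd_iterate_def Let_def x_def y_def s_def t_def)
qed

section \<open>Couplings and transport costs\<close>

text \<open>
  The synchronous coupling: draw \<open>(z, z')\<close> from \<open>G\<close> and one common \<open>w\<close> from \<open>Q\<close>, independently of each
  other. Each component then has the law of the corresponding chain, whatever \<open>G\<close> is, and a pointwise
  comparison of the costs passes to the integrals.
\<close>

lemma coupling_pushforward:
  assumes Q: "prob_space Q" and G: "G \<in> couplings P P'" and P': "sets P' = sets P"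
    and F: "F \<in> P \<Otimes>\<^sub>M Q \<rightarrow>\<^sub>M N"
    and c0: "c0 \<in> borel_measurable (P \<Otimes>\<^sub>M P)" and c1: "c1 \<in> borel_measurable (N \<Otimes>\<^sub>M N)"
    and le: "\<And>z z' w. c1 (F (z, w), F (z', w)) \<le> c0 (z, z')"
  shows "\<exists>H\<in>couplings (distr (P \<Otimes>\<^sub>M Q) N F) (distr (P' \<Otimes>\<^sub>M Q) N F). (\<integral>\<^sup>+ p. c1 p \<partial>H) \<le> (\<integral>\<^sup>+ p. c0 p \<partial>G)"
proof -
  interpret Q: prob_space Q by (rule Q)
  have Gp: "prob_space G" and sG: "sets G = sets (P \<Otimes>\<^sub>M P')"
    and mP: "distr G P fst = P" and mP': "distr G P' snd = P'"
    using G by (auto simp: couplings_def)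
  interpret G: prob_space G by (rule Gp)
  interpret GQ: pair_prob_space G Q ..
  have F': "F \<in> P' \<Otimes>\<^sub>M Q \<rightarrow>\<^sub>M N"
    using F P' by (simp cong: measurable_cong_sets sets_pair_measure_cong)
  have fG: "fst \<in> G \<rightarrow>\<^sub>M P" and sndG: "snd \<in> G \<rightarrow>\<^sub>M P'"
    by (simp_all cong: measurable_cong_sets add: measurable_cong_sets[OF sG refl])
  have lift1: "(\<lambda>(a, w). (fst a, w)) \<in> G \<Otimes>\<^sub>M Q \<rightarrow>\<^sub>M P \<Otimes>\<^sub>M Q"
    using fG by (auto intro!: measurable_Pair measurable_compose[OF measurable_fst] simp: case_prod_unfold)
  have lift2: "(\<lambda>(a, w). (snd a, w)) \<in> G \<Otimes>\<^sub>M Q \<rightarrow>\<^sub>M P' \<Otimes>\<^sub>M Q"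
    using sndG by (auto intro!: measurable_Pair measurable_compose[OF measurable_fst] simp: case_prod_unfold)
  have sfQ: "sigma_finite_measure (distr Q Q (\<lambda>w. w))"
    by (simp add: Q.sigma_finite_measure_axioms)
  have PQ: "distr (G \<Otimes>\<^sub>M Q) (P \<Otimes>\<^sub>M Q) (\<lambda>(a, w). (fst a, w)) = P \<Otimes>\<^sub>M Q"
    using pair_measure_distr[OF fG measurable_ident_sets[OF refl] sfQ] by (simp add: mP)
  have P'Q: "distr (G \<Otimes>\<^sub>M Q) (P' \<Otimes>\<^sub>M Q) (\<lambda>(a, w). (snd a, w)) = P' \<Otimes>\<^sub>M Q"
    using pair_measure_distr[OF sndG measurable_ident_sets[OF refl] sfQ] by (simp add: mP')
  define \<Phi> where "\<Phi> p = (F (fst (fst p), snd p), F (snd (fst p), snd p))" for p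
  have \<Phi>1: "(\<lambda>p. fst (\<Phi> p)) \<in> G \<Otimes>\<^sub>M Q \<rightarrow>\<^sub>M N" and \<Phi>2: "(\<lambda>p. snd (\<Phi> p)) \<in> G \<Otimes>\<^sub>M Q \<rightarrow>\<^sub>M N"
    using measurable_compose[OF lift1 F] measurable_compose[OF lift2 F']
    by (simp_all add: \<Phi>_def case_prod_unfold)
  have \<Phi>: "\<Phi> \<in> G \<Otimes>\<^sub>M Q \<rightarrow>\<^sub>M N \<Otimes>\<^sub>M N"
    using measurable_Pair[OF \<Phi>1 \<Phi>2] by simp
  define H where "H = distr (G \<Otimes>\<^sub>M Q) (N \<Otimes>\<^sub>M N) \<Phi>"
  have "distr H N fst = distr (G \<Otimes>\<^sub>M Q) N (F \<circ> (\<lambda>(a, w). (fst a, w)))"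
    unfolding H_def by (subst distr_distr[OF _ \<Phi>]) (auto simp: \<Phi>_def comp_def case_prod_unfold)
  also have "\<dots> = distr (P \<Otimes>\<^sub>M Q) N F"
    by (rule distr_distr[OF F lift1, unfolded PQ, symmetric])
  finally have H1: "distr H N fst = distr (P \<Otimes>\<^sub>M Q) N F" .
  have "distr H N snd = distr (G \<Otimes>\<^sub>M Q) N (F \<circ> (\<lambda>(a, w). (snd a, w)))"
    unfolding H_def by (subst distr_distr[OF _ \<Phi>]) (auto simp: \<Phi>_def comp_def case_prod_unfold)
  also have "\<dots> = distr (P' \<Otimes>\<^sub>M Q) N F"
    by (rule distr_distr[OF F' lift2, unfolded P'Q, symmetric])
  finally have H2: "distr H N snd = distr (P' \<Otimes>\<^sub>M Q) N F" .
  have "prob_space H" unfolding H_def by (rule GQ.prob_space_distr[OF \<Phi>])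
  moreover have "distr H (distr (P \<Otimes>\<^sub>M Q) N F) fst = distr H N fst"
    "distr H (distr (P' \<Otimes>\<^sub>M Q) N F) snd = distr H N snd"
    by (rule distr_cong; simp)+
  ultimately have "H \<in> couplings (distr (P \<Otimes>\<^sub>M Q) N F) (distr (P' \<Otimes>\<^sub>M Q) N F)"
    unfolding couplings_def using H1 H2 by (simp add: H_def cong: sets_pair_measure_cong)
  moreover have "(\<integral>\<^sup>+ p. c1 p \<partial>H) \<le> (\<integral>\<^sup>+ p. c0 p \<partial>G)"
  proof -
    have c0': "c0 \<in> borel_measurable G"
      using c0 sG P' by (simp cong: measurable_cong_sets sets_pair_measure_cong)
    have "(\<integral>\<^sup>+ p. c1 p \<partial>H) = (\<integral>\<^sup>+ p. c1 (\<Phi> p) \<partial>(G \<Otimes>\<^sub>M Q))"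
      unfolding H_def using \<Phi> c1 by (intro nn_integral_distr) simp_all
    also have "\<dots> \<le> (\<integral>\<^sup>+ p. c0 (fst p) \<partial>(G \<Otimes>\<^sub>M Q))"
      using le by (intro nn_integral_mono) (auto simp: \<Phi>_def)
    also have "\<dots> = (\<integral>\<^sup>+ a. \<integral>\<^sup>+ w. c0 (fst (a, w)) \<partial>Q \<partial>G)"
      by (rule Q.nn_integral_fst[symmetric]) (rule measurable_compose[OF measurable_fst c0'])
    also have "\<dots> = (\<integral>\<^sup>+ p. c0 p \<partial>G)" by (simp add: Q.emeasure_space_1)
    finally show ?thesis .
  qed
  ultimately show ?thesis by blast
qed

lemma ennreal_sqrt_mono: "s \<le> t \<Longrightarrow> ennreal_sqrt s \<le> ennreal_sqrt t"
  unfolding ennreal_sqrt_def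
  by (auto simp: top_unique intro!: ennreal_leI enn2real_mono simp: less_top)

lemma ennreal_sqrt_scale:
  assumes "C > 0"
  shows "ennreal_sqrt (ennreal (C\<^sup>2) * t) = ennreal C * ennreal_sqrt t"
  using assms
  by (cases t) (auto simp: ennreal_sqrt_def ennreal_mult_top ennreal_mult[symmetric] real_sqrt_mult)

text \<open>
  Transfers a comparison of couplings to the transport distances. The proof divides by \<open>C\<close>, so that the
  infimum on the right is approached by its greatest-lower-bound property.
\<close>

lemma INF_ennreal_sqrt_le:
  assumes C: "C > 0"
    and le: "\<And>G. G \<in> A \<Longrightarrow> \<exists>H\<in>B. J H \<le> ennreal (C\<^sup>2) * I G"
  shows "(INF H\<in>B. ennreal_sqrt (J H)) \<le> ennreal C * (INF G\<in>A. ennreal_sqrt (I G))"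
proof -
  let ?l = "INF H\<in>B. ennreal_sqrt (J H)"
  have "ennreal (1 / C) * ?l \<le> (INF G\<in>A. ennreal_sqrt (I G))"
  proof (rule INF_greatest)
    fix G assume "G \<in> A"
    with le obtain H where H: "H \<in> B" "J H \<le> ennreal (C\<^sup>2) * I G" by blast
    have "?l \<le> ennreal_sqrt (J H)" using H(1) by (rule INF_lower)
    also have "\<dots> \<le> ennreal C * ennreal_sqrt (I G)"
      using ennreal_sqrt_mono[OF H(2)] by (simp add: ennreal_sqrt_scale[OF C])
    finally have "ennreal (1 / C) * ?l \<le> ennreal (1 / C) * (ennreal C * ennreal_sqrt (I G))"
      by (rule mult_left_mono) simp
    also have "\<dots> = ennreal_sqrt (I G)"
      using C by (simp add: mult.assoc[symmetric] ennreal_mult[symmetric])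
    finally show "ennreal (1 / C) * ?l \<le> ennreal_sqrt (I G)" .
  qed
  then have "ennreal C * (ennreal (1 / C) * ?l) \<le> ennreal C * (INF G\<in>A. ennreal_sqrt (I G))"
    by (rule mult_left_mono) simp
  then show ?thesis using C by (simp add: mult.assoc[symmetric] ennreal_mult[symmetric])
qed

lemma coupling_cost_measurable:
  "(\<lambda>p :: ('a::euclidean_space \<times> 'b::euclidean_space) \<times> ('a \<times> 'b).
      ennreal (a * (norm (fst (fst p) - fst (snd p)))\<^sup>2 + b * (norm (snd (fst p) - snd (snd p)))\<^sup>2))
   \<in> borel_measurable (borel \<Otimes>\<^sub>M borel)"
  unfolding borel_prod
  by (intro measurable_compose[OF _ measurable_ennreal] borel_measurable_continuous_onI continuous_intros)

section \<open>The law of the chain\<close>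

lemma pd_orbit_measurable:
  fixes K :: "'a::euclidean_space \<Rightarrow> 'b::euclidean_space"
  assumes K: "linear K" and R: "firmly_nonexpansive R" and S: "firmly_nonexpansive S"
  shows "(\<lambda>(z, w). pd_orbit \<tau> \<sigma> K R S w z n) \<in> borel_measurable (borel \<Otimes>\<^sub>M Pi\<^sub>M UNIV (\<lambda>_. borel))"
proof (induction n)
  case 0
  have "(\<lambda>z :: 'a \<times> 'b. (fst z, snd z, fst z)) \<in> borel_measurable borel"
    by (intro borel_measurable_continuous_onI continuous_intros)
  from measurable_compose[OF measurable_fst this] show ?case
    by (simp add: case_prod_unfold)
next
  case (Suc n)
  let ?N = "(borel :: ('a \<times> 'b) measure) \<Otimes>\<^sub>M Pi\<^sub>M UNIV (\<lambda>_::nat. borel :: 'a measure)"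
  define s where "s p = pd_orbit \<tau> \<sigma> K R S (snd p) (fst p) n" for p
  have s: "s \<in> borel_measurable ?N"
    using Suc.IH by (simp add: s_def[abs_def] case_prod_unfold)
  have [measurable]: "(\<lambda>p. fst (s p)) \<in> borel_measurable ?N"
    by (rule measurable_compose[OF s]) (intro borel_measurable_continuous_onI continuous_intros)
  have [measurable]: "(\<lambda>p. fst (snd (s p))) \<in> borel_measurable ?N"
    by (rule measurable_compose[OF s]) (intro borel_measurable_continuous_onI continuous_intros)
  have [measurable]: "(\<lambda>p. snd (snd (s p))) \<in> borel_measurable ?N"
    by (rule measurable_compose[OF s]) (intro borel_measurable_continuous_onI continuous_intros)
  have [measurable]: "R \<in> borel_measurable borel" "S \<in> borel_measurable borel"
    using R S by (auto intro!: borel_measurable_continuous_onI firmly_nonexpansive_continuous)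
  have [measurable]: "K \<in> borel_measurable borel" "adjoint K \<in> borel_measurable borel"
    using K adjoint_linear[OF K]
    by (auto intro!: borel_measurable_continuous_onI linear_continuous_on simp: linear_conv_bounded_linear)
  show ?case
    unfolding pd_orbit.simps Let_def case_prod_unfold s_def[symmetric] by measurable
qed

lemma pd_iterate_measurable:
  fixes K :: "'a::euclidean_space \<Rightarrow> 'b::euclidean_space"
  assumes "linear K" "firmly_nonexpansive R" "firmly_nonexpansive S"
  shows "(\<lambda>(z, w). pd_iterate \<tau> \<sigma> K R S n w z) \<in> borel_measurable (borel \<Otimes>\<^sub>M Pi\<^sub>M UNIV (\<lambda>_. borel))"
proof -
  have "(\<lambda>s :: 'a \<times> 'b \<times> 'a. (fst s, fst (snd s))) \<in> borel_measurable borel"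
    by (intro borel_measurable_continuous_onI continuous_intros)
  from measurable_compose[OF pd_orbit_measurable[OF assms] this] show ?thesis
    by (simp add: pd_iterate_def Let_def case_prod_unfold)
qed

text \<open>
  Joint independence of \<open>Z0\<close> and the single \<open>W n\<close> makes the sigma-algebra of \<open>Z0\<close> independent of the one
  generated by all \<open>W n\<close> together, hence the joint law of a function of \<open>Z0\<close> and the whole sequence is a
  product. The function \<open>f\<close> is there to select from \<open>Z0\<close> the initial value of one of two chains.
\<close>

lemma distr_indep_sequence:
  assumes M: "prob_space M"
    and indep: "prob_space.indep_sets M
       (case_nat (sets (vimage_algebra (space M) Z0 N0)) (\<lambda>n. sets (vimage_algebra (space M) (W n) N))) UNIV"
    and Z0: "Z0 \<in> M \<rightarrow>\<^sub>M N0" and W: "\<And>n. W n \<in> M \<rightarrow>\<^sub>M N"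
    and f: "f \<in> N0 \<rightarrow>\<^sub>M N1"
  shows "distr M (N1 \<Otimes>\<^sub>M Pi\<^sub>M UNIV (\<lambda>_. N)) (\<lambda>\<omega>. (f (Z0 \<omega>), \<lambda>n. W n \<omega>)) =
         distr M N1 (\<lambda>\<omega>. f (Z0 \<omega>)) \<Otimes>\<^sub>M distr M (Pi\<^sub>M UNIV (\<lambda>_. N)) (\<lambda>\<omega> n. W n \<omega>)"
    (is "?J = ?P \<Otimes>\<^sub>M ?Q")
proof -
  interpret M: prob_space M by (rule M)
  define E where "E = case_nat (sets (vimage_algebra (space M) Z0 N0)) (\<lambda>n. sets (vimage_algebra (space M) (W n) N))"
  have fZ: "(\<lambda>\<omega>. f (Z0 \<omega>)) \<in> M \<rightarrow>\<^sub>M N1" using Z0 f by (rule measurable_compose)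
  have Wseq: "(\<lambda>\<omega> n. W n \<omega>) \<in> M \<rightarrow>\<^sub>M Pi\<^sub>M UNIV (\<lambda>_. N)"
    by (rule measurable_PiM_single') (use W measurable_space[OF W] in auto)
  have E_pow: "E i \<subseteq> Pow (space M)" for i
    using sets.space_closed[of "vimage_algebra (space M) Z0 N0"]
      sets.space_closed[of "vimage_algebra (space M) (W k) N" for k]
    by (cases i) (auto simp: E_def)
  define G where "G = case_bool {0::nat} (range Suc)"
  have "M.indep_sets E UNIV" using indep by (simp add: E_def)
  then have "M.indep_sets E (\<Union>j\<in>UNIV. G j)" by (rule M.indep_sets_mono_index[rotated]) simp
  then have ind: "M.indep_sets (\<lambda>j. sigma_sets (space M) (\<Union>i\<in>G j. E i)) UNIV"
  proof (rule M.indep_sets_collect_sigma)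
    fix i show "Int_stable (E i)" by (cases i) (auto simp: E_def Int_stable_def)
    show "disjoint_family_on G UNIV"
      by (auto simp: disjoint_family_on_def G_def split: bool.splits)
  qed
  let ?S = "\<lambda>j. sigma_sets (space M) (\<Union>i\<in>G j. E i)"
  have prod: "M.prob (A \<inter> B) = M.prob A * M.prob B" if "A \<in> ?S True" "B \<in> ?S False" for A B
    using M.indep_setsD[OF ind, of UNIV "case_bool A B"] that
    by (auto simp: UNIV_bool ac_simps)
  have evZ: "(\<lambda>\<omega>. f (Z0 \<omega>)) -` A \<inter> space M \<in> ?S True" if A: "A \<in> sets N1" for A
  proof -
    have "f -` A \<inter> space N0 \<in> sets N0" using f A by (rule measurable_sets)
    then have "Z0 -` (f -` A \<inter> space N0) \<inter> space M \<in> E 0"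
      unfolding E_def nat.case by (rule in_vimage_algebra)
    moreover have "Z0 -` (f -` A \<inter> space N0) \<inter> space M = (\<lambda>\<omega>. f (Z0 \<omega>)) -` A \<inter> space M"
      using measurable_space[OF Z0] by auto
    ultimately show ?thesis by (auto simp: G_def)
  qed
  define T where "T = sigma (space M) (\<Union>i\<in>G False. E i)"
  have T: "space T = space M" "sets T = ?S False"
    using E_pow unfolding T_def by (auto intro!: space_measure_of sets_measure_of)
  have "(\<lambda>\<omega> n. W n \<omega>) \<in> T \<rightarrow>\<^sub>M Pi\<^sub>M UNIV (\<lambda>_. N)"
  proof (rule measurable_PiM_single')
    fix n
    have "W n -` A \<inter> space M \<in> ?S False" if "A \<in> sets N" for A
    proof -
      have "W n -` A \<inter> space M \<in> E (Suc n)"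
        unfolding E_def nat.case using that by (rule in_vimage_algebra)
      then show ?thesis by (auto simp: G_def)
    qed
    then show "W n \<in> T \<rightarrow>\<^sub>M N"
      using measurable_space[OF W] by (intro measurableI) (auto simp: T)
  qed (use measurable_space[OF W] T in auto)
  then have evW: "(\<lambda>\<omega> n. W n \<omega>) -` B \<inter> space M \<in> ?S False" if "B \<in> sets (Pi\<^sub>M UNIV (\<lambda>_. N))" for B
    using measurable_sets[OF _ that] T by metis
  have "?P \<Otimes>\<^sub>M ?Q = ?J"
  proof (rule pair_measure_eqI)
    show "sigma_finite_measure ?P" "sigma_finite_measure ?Q"
      using M.prob_space_distr[OF fZ] M.prob_space_distr[OF Wseq]
      by (auto intro: prob_space_imp_sigma_finite)
  next
    fix A B assume "A \<in> sets ?P" "B \<in> sets ?Q"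
    then have A: "A \<in> sets N1" and B: "B \<in> sets (Pi\<^sub>M UNIV (\<lambda>_. N))" by auto
    have "emeasure ?J (A \<times> B) = emeasure M ((\<lambda>\<omega>. (f (Z0 \<omega>), \<lambda>n. W n \<omega>)) -` (A \<times> B) \<inter> space M)"
      using A B fZ Wseq by (intro emeasure_distr) auto
    also have "(\<lambda>\<omega>. (f (Z0 \<omega>), \<lambda>n. W n \<omega>)) -` (A \<times> B) \<inter> space M =
        ((\<lambda>\<omega>. f (Z0 \<omega>)) -` A \<inter> space M) \<inter> ((\<lambda>\<omega> n. W n \<omega>) -` B \<inter> space M)" by auto
    finally show "emeasure ?P A * emeasure ?Q B = emeasure ?J (A \<times> B)"
      using A B fZ Wseq prod[OF evZ[OF A] evW[OF B]]
      by (simp add: emeasure_distr M.emeasure_eq_measure ennreal_mult)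
  qed (simp cong: sets_pair_measure_cong)
  then show ?thesis ..
qed

lemma pd_langevin_eq_pd_iterate:
  assumes "pd_langevin M K f g \<tau> \<sigma> 1 \<xi> X Y X\<theta>" "\<omega> \<in> space M"
  shows "(X n \<omega>, Y n \<omega>) =
    pd_iterate \<tau> \<sigma> K (prox \<sigma> (convex_conjugate f)) (prox \<tau> g) n (\<lambda>k. \<xi> (Suc k) \<omega>) (X 0 \<omega>, Y 0 \<omega>)"
proof -
  have "pd_orbit \<tau> \<sigma> K (prox \<sigma> (convex_conjugate f)) (prox \<tau> g) (\<lambda>k. \<xi> (Suc k) \<omega>) (X 0 \<omega>, Y 0 \<omega>) n
     = (X n \<omega>, Y n \<omega>, X\<theta> n \<omega>)"
    using assms by (induction n) (simp_all add: pd_langevin_def Let_def)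
  then show ?thesis by (simp add: pd_iterate_def)
qed

lemma gaussian_noise_measurable:
  assumes "gaussian_noise M Z0 \<xi>"
  shows "\<xi> (Suc n) \<in> borel_measurable M"
proof -
  have "distributed M lborel (\<xi> (Suc n)) (\<lambda>x. ennreal (std_gaussian_density x))"
    using assms unfolding gaussian_noise_def by blast
  then have "\<xi> (Suc n) \<in> M \<rightarrow>\<^sub>M lborel" by (rule distributed_measurable)
  then show ?thesis by simp
qed

text \<open>
  The position of the chain is one fixed measurable function of the initial value and the noise
  sequence, which are independent. Its law is therefore determined by the initial law and the law \<open>Q\<close>
  of the noise, and it can be reproduced on any space that carries another coupling of the initial laws.
\<close>

lemma pd_langevin_law:
  fixes K :: "real ^ 'd \<Rightarrow> real ^ 'm"
  assumes M: "prob_space M" and Z0: "Z0 \<in> borel_measurable M" and noise: "gaussian_noise M Z0 \<xi>"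
    and iter: "pd_langevin M K f g \<tau> \<sigma> 1 \<xi> X Y X\<theta>"
    and h: "h \<in> borel_measurable borel" "\<And>\<omega>. h (Z0 \<omega>) = (X 0 \<omega>, Y 0 \<omega>)"
    and K: "linear K"
    and R: "firmly_nonexpansive (prox \<sigma> (convex_conjugate f))" and S: "firmly_nonexpansive (prox \<tau> g)"
    and Q: "Q = distr M (Pi\<^sub>M UNIV (\<lambda>_. borel)) (\<lambda>\<omega> n. \<xi> (Suc n) \<omega>)"
    and F: "F = (\<lambda>(z, w). pd_iterate \<tau> \<sigma> K (prox \<sigma> (convex_conjugate f)) (prox \<tau> g) n w z)"
  shows "distr M borel (\<lambda>\<omega>. (X n \<omega>, Y n \<omega>)) =
           distr (distr M borel (\<lambda>\<omega>. (X 0 \<omega>, Y 0 \<omega>)) \<Otimes>\<^sub>M Q) borel F" (is ?joint)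
    and "distr M borel (X n) =
           distr (distr M borel (\<lambda>\<omega>. (X 0 \<omega>, Y 0 \<omega>)) \<Otimes>\<^sub>M Q) borel (\<lambda>p. fst (F p))" (is ?marginal)
proof -
  let ?B = "borel :: ((real ^ 'd) \<times> (real ^ 'm)) measure"
  let ?W = "Pi\<^sub>M UNIV (\<lambda>_::nat. borel :: (real ^ 'd) measure)"
  let ?in = "\<lambda>\<omega>. (h (Z0 \<omega>), \<lambda>k. \<xi> (Suc k) \<omega>)"
  have W: "\<xi> (Suc k) \<in> borel_measurable M" for k
    using gaussian_noise_measurable[OF noise] .
  have Wseq: "(\<lambda>\<omega> k. \<xi> (Suc k) \<omega>) \<in> M \<rightarrow>\<^sub>M ?W"
    by (rule measurable_PiM_single') (use W in auto)
  have F_meas: "F \<in> ?B \<Otimes>\<^sub>M ?W \<rightarrow>\<^sub>M ?B"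
    unfolding F by (rule pd_iterate_measurable[OF K R S])
  have input: "?in \<in> M \<rightarrow>\<^sub>M ?B \<Otimes>\<^sub>M ?W"
    using measurable_compose[OF Z0 h(1)] Wseq by (rule measurable_Pair)
  have eq: "(X n \<omega>, Y n \<omega>) = F (?in \<omega>)" if "\<omega> \<in> space M" for \<omega>
    unfolding F h(2) prod.case by (rule pd_langevin_eq_pd_iterate[OF iter that])
  have law_in: "distr M (?B \<Otimes>\<^sub>M ?W) ?in = distr M ?B (\<lambda>\<omega>. (X 0 \<omega>, Y 0 \<omega>)) \<Otimes>\<^sub>M Q"
    using distr_indep_sequence[where W = "\<lambda>k. \<xi> (Suc k)", OF M _ Z0 W h(1)] noise
    unfolding gaussian_noise_def h(2) Q by blast
  have "distr M ?B (\<lambda>\<omega>. (X n \<omega>, Y n \<omega>)) = distr M ?B (F \<circ> ?in)"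
    unfolding comp_def by (rule distr_cong[OF refl refl eq])
  also have "\<dots> = distr (distr M (?B \<Otimes>\<^sub>M ?W) ?in) ?B F"
    by (rule distr_distr[OF F_meas input, symmetric])
  finally show ?joint unfolding law_in .
  have "fst \<in> ?B \<rightarrow>\<^sub>M borel" by (intro borel_measurable_continuous_onI continuous_intros)
  then have fstF: "(\<lambda>p. fst (F p)) \<in> ?B \<Otimes>\<^sub>M ?W \<rightarrow>\<^sub>M borel"
    by (rule measurable_compose[OF F_meas])
  have "distr M borel (X n) = distr M borel ((\<lambda>p. fst (F p)) \<circ> ?in)"
    unfolding comp_def by (rule distr_cong[OF refl refl]) (simp flip: eq)
  also have "\<dots> = distr (distr M (?B \<Otimes>\<^sub>M ?W) ?in) borel (\<lambda>p. fst (F p))"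
    by (rule distr_distr[OF fstF input, symmetric])
  finally show ?marginal unfolding law_in .
qed

section \<open>Nonexpansiveness in transport distance\<close>

theorem theorem4p1:
  fixes K :: "real ^ 'd \<Rightarrow> real ^ 'm"
    and f :: "real ^ 'm \<Rightarrow> ereal" and g :: "real ^ 'd \<Rightarrow> ereal"
    and \<tau> \<sigma> lam L :: real
    and M :: "'w measure"
    and \<xi> :: "nat \<Rightarrow> 'w \<Rightarrow> real ^ 'd"
    and X X\<theta> X' X\<theta>' :: "nat \<Rightarrow> 'w \<Rightarrow> real ^ 'd"
    and Y Y' :: "nat \<Rightarrow> 'w \<Rightarrow> real ^ 'm"
    and \<pi> \<pi>' :: "nat \<Rightarrow> ((real ^ 'd) \<times> (real ^ 'm)) measure"
    and \<mu> \<mu>' :: "nat \<Rightarrow> (real ^ 'd) measure"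
  assumes K: "linear K" "L = onorm K"
    and f: "\<And>y. f y \<noteq> -\<infinity>" "ereal_convex f" "lower_semicont f"
    and g: "\<And>x. g x \<noteq> -\<infinity>" "ereal_convex g" "lower_semicont g"
    and target: "0 < (\<integral>\<^sup>+ x. exp_neg (f (K x) + g x) \<partial>lborel)"
                "(\<integral>\<^sup>+ x. exp_neg (f (K x) + g x) \<partial>lborel) < \<infinity>"
    and steps: "\<tau> > 0" "\<sigma> > 0" "lam = \<sigma> / \<tau>"
    and M: "prob_space M"
    and initial_meas: "X 0 \<in> borel_measurable M" "Y 0 \<in> borel_measurable M"
                      "X' 0 \<in> borel_measurable M" "Y' 0 \<in> borel_measurable M"
    and initial_moments:
      "integrable M (\<lambda>\<omega>. (norm (X 0 \<omega>))\<^sup>2)" "integrable M (\<lambda>\<omega>. (norm (Y 0 \<omega>))\<^sup>2)"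
      "integrable M (\<lambda>\<omega>. (norm (X' 0 \<omega>))\<^sup>2)" "integrable M (\<lambda>\<omega>. (norm (Y' 0 \<omega>))\<^sup>2)"
    and noise: "gaussian_noise M (\<lambda>\<omega>. ((X 0 \<omega>, Y 0 \<omega>), (X' 0 \<omega>, Y' 0 \<omega>))) \<xi>"
    and iteration: "pd_langevin M K f g \<tau> \<sigma> 1 \<xi> X Y X\<theta>"
    and iteration': "pd_langevin M K f g \<tau> \<sigma> 1 \<xi> X' Y' X\<theta>'"
    and laws: "\<And>n. \<pi> n = distr M borel (\<lambda>\<omega>. (X n \<omega>, Y n \<omega>))"
              "\<And>n. \<pi>' n = distr M borel (\<lambda>\<omega>. (X' n \<omega>, Y' n \<omega>))"
              "\<And>n. \<mu> n = distr M borel (X n)"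
              "\<And>n. \<mu>' n = distr M borel (X' n)"
  shows "(\<tau> * \<sigma> * L\<^sup>2 \<le> 1 \<longrightarrow>
            (\<forall>N. wasserstein2 (\<mu> N) (\<mu>' N) \<le> transport_dist 1 (inverse lam) (\<pi> 0) (\<pi>' 0))) \<and>
         (\<tau> * \<sigma> * L\<^sup>2 < 1 \<longrightarrow>
            (let C = (1 - \<tau> * \<sigma> * L\<^sup>2) powr (- 1 / 2) in
              \<forall>N. transport_dist 1 (inverse lam) (\<pi> N) (\<pi>' N)
                    \<le> ennreal C * transport_dist 1 (inverse lam) (\<pi> 0) (\<pi>' 0)))"
proof -
  interpret M: prob_space M by (rule M)
  obtain x where "exp_neg (f (K x) + g x) \<noteq> 0"
  proof -
    have "\<exists>x. exp_neg (f (K x) + g x) \<noteq> 0"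
    proof (rule ccontr)
      assume "\<not> (\<exists>x. exp_neg (f (K x) + g x) \<noteq> 0)"
      then have "(\<lambda>x. exp_neg (f (K x) + g x)) = (\<lambda>_. 0)" by blast
      then have "(\<integral>\<^sup>+ x. exp_neg (f (K x) + g x) \<partial>lborel) = 0" by simp
      with target(1) show False by simp
    qed
    then show ?thesis using that by blast
  qed
  then have "f (K x) + g x \<noteq> \<infinity>" by (auto simp: exp_neg_def)
  then have proper: "ereal_proper f" "ereal_proper g"
    using f(1) g(1) by (auto simp: ereal_proper_def)
  define R where "R = prox \<sigma> (convex_conjugate f)"
  define S where "S = prox \<tau> g"
  have R: "firmly_nonexpansive R"
    unfolding R_def using resolvent_exists_conjugate[OF proper(1) f(2,3) steps(2)] steps(2)
    by (rule firmly_nonexpansive_prox)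
  have S: "firmly_nonexpansive S"
    unfolding S_def using resolvent_exists[OF proper(2) g(2,3) steps(1)] steps(1)
    by (rule firmly_nonexpansive_prox)
  let ?B = "borel :: ((real ^ 'd) \<times> (real ^ 'm)) measure"
  let ?W = "Pi\<^sub>M UNIV (\<lambda>_::nat. borel :: (real ^ 'd) measure)"
  let ?Z0 = "\<lambda>\<omega>. ((X 0 \<omega>, Y 0 \<omega>), (X' 0 \<omega>, Y' 0 \<omega>))"
  have Z0: "?Z0 \<in> borel_measurable M" using initial_meas by measurable
  have W: "\<xi> (Suc n) \<in> borel_measurable M" for n
    using gaussian_noise_measurable[OF noise] .
  have Wseq: "(\<lambda>\<omega> n. \<xi> (Suc n) \<omega>) \<in> M \<rightarrow>\<^sub>M ?W"
    by (rule measurable_PiM_single') (use W in auto)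
  define Q where "Q = distr M ?W (\<lambda>\<omega> n. \<xi> (Suc n) \<omega>)"
  have Q: "prob_space Q" unfolding Q_def by (rule M.prob_space_distr[OF Wseq])
  define F where "F n = (\<lambda>(z, w). pd_iterate \<tau> \<sigma> K R S n w z)" for n
  have F: "F n \<in> ?B \<Otimes>\<^sub>M ?W \<rightarrow>\<^sub>M ?B" for n
    unfolding F_def by (rule pd_iterate_measurable[OF K(1) R S])
  have fst_meas: "fst \<in> borel_measurable (borel :: (((real ^ 'd) \<times> (real ^ 'm)) \<times> ((real ^ 'd) \<times> (real ^ 'm))) measure)"
    and snd_meas: "snd \<in> borel_measurable (borel :: (((real ^ 'd) \<times> (real ^ 'm)) \<times> ((real ^ 'd) \<times> (real ^ 'm))) measure)"
    by (intro borel_measurable_continuous_onI continuous_intros)+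
  note law = pd_langevin_law[OF M Z0 noise iteration fst_meas _ K(1) R[unfolded R_def] S[unfolded S_def] Q_def refl]
  note law' = pd_langevin_law[OF M Z0 noise iteration' snd_meas _ K(1) R[unfolded R_def] S[unfolded S_def] Q_def refl]
  have \<pi>: "\<pi> n = distr (\<pi> 0 \<Otimes>\<^sub>M Q) ?B (F n)" and \<mu>: "\<mu> n = distr (\<pi> 0 \<Otimes>\<^sub>M Q) borel (\<lambda>p. fst (F n p))" for n
    unfolding laws(1,3) F_def R_def S_def by (rule law, simp)+
  have \<pi>': "\<pi>' n = distr (\<pi>' 0 \<Otimes>\<^sub>M Q) ?B (F n)" and \<mu>': "\<mu>' n = distr (\<pi>' 0 \<Otimes>\<^sub>M Q) borel (\<lambda>p. fst (F n p))" for n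
    unfolding laws(2,4) F_def R_def S_def by (rule law', simp)+
  have fstB: "fst \<in> ?B \<rightarrow>\<^sub>M borel"
    by (intro borel_measurable_continuous_onI continuous_intros)
  have sets_PQ: "sets (\<rho> \<Otimes>\<^sub>M Q) = sets (?B \<Otimes>\<^sub>M ?W)" if "sets \<rho> = sets ?B" for \<rho> :: "((real ^ 'd) \<times> (real ^ 'm)) measure"
    using that by (intro sets_pair_measure_cong) (simp_all add: Q_def)
  have sets_\<pi>: "sets (\<pi> n) = sets ?B" "sets (\<pi>' n) = sets ?B" for n by (simp_all add: laws)
  have F': "F n \<in> \<pi> 0 \<Otimes>\<^sub>M Q \<rightarrow>\<^sub>M ?B" for n
    using F by (simp add: measurable_cong_sets[OF sets_PQ[OF sets_\<pi>(1)] refl])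
  have XF: "(\<lambda>p. fst (F n p)) \<in> \<pi> 0 \<Otimes>\<^sub>M Q \<rightarrow>\<^sub>M borel" for n
    by (rule measurable_compose[OF F' fstB])
  have inv: "inverse lam = \<tau> / \<sigma>" using steps by simp
  define \<kappa> where "\<kappa> = 1 - \<tau> * \<sigma> * L\<^sup>2"
  have \<tau>\<sigma>: "0 \<le> \<tau> / \<sigma>" "0 \<le> \<tau> * \<sigma> * L\<^sup>2" using steps by auto
  define c where "c p = (norm (fst (fst p) - fst (snd p)))\<^sup>2 + \<tau> / \<sigma> * (norm (snd (fst p) - snd (snd p)))\<^sup>2"
    for p :: "((real ^ 'd) \<times> (real ^ 'm)) \<times> ((real ^ 'd) \<times> (real ^ 'm))"
  have c0: "0 \<le> c p" for p unfolding c_def using \<tau>\<sigma>(1) by (intro add_nonneg_nonneg mult_nonneg_nonneg) auto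
  have c_meas: "(\<lambda>p. ennreal (c p)) \<in> borel_measurable (?B \<Otimes>\<^sub>M ?B)"
    using coupling_cost_measurable[of 1 "\<tau> / \<sigma>"] by (simp add: c_def[abs_def])
  have c_meas': "(\<lambda>p. ennreal (c p)) \<in> borel_measurable (\<pi> 0 \<Otimes>\<^sub>M \<pi> 0)"
    using c_meas by (simp add: measurable_cong_sets[OF sets_pair_measure_cong[OF sets_\<pi>(1) sets_\<pi>(1)] refl])
  have T: "transport_dist 1 (inverse lam) P P' = (INF G\<in>couplings P P'. ennreal_sqrt (\<integral>\<^sup>+ p. ennreal (c p) \<partial>G))"
    for P P' :: "((real ^ 'd) \<times> (real ^ 'm)) measure"
    by (simp add: transport_dist_def inv c_def case_prod_unfold)
  have contr: "(norm (fst (F n (z, w)) - fst (F n (z', w))))\<^sup>2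
      + \<kappa> * (\<tau> / \<sigma> * (norm (snd (F n (z, w)) - snd (F n (z', w))))\<^sup>2) \<le> c (z, z')"
    if "0 \<le> \<kappa>" for n z z' w
    using pd_orbit_contraction[OF K(1) steps(1,2) _ R S refl refl, of n w z z'] that
    by (simp add: \<kappa>_def K(2) F_def c_def)
  show ?thesis unfolding Let_def
  proof (intro conjI impI allI)
    fix N assume "\<tau> * \<sigma> * L\<^sup>2 \<le> 1"
    then have \<kappa>: "0 \<le> \<kappa>" by (simp add: \<kappa>_def)
    let ?d = "\<lambda>p :: (real ^ 'd) \<times> (real ^ 'd). ennreal ((norm (fst p - snd p))\<^sup>2)"
    have d_meas: "?d \<in> borel_measurable (borel \<Otimes>\<^sub>M borel)"
      by measurable
    have le: "?d (fst (F N (z, w)), fst (F N (z', w))) \<le> ennreal (c (z, z'))" for z z' w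
      using contr[OF \<kappa>, of N z w z'] mult_nonneg_nonneg[OF \<kappa> mult_nonneg_nonneg[OF \<tau>\<sigma>(1) zero_le_power2]]
      by (auto intro!: ennreal_leI intro: order_trans[rotated])
    have "wasserstein2 (\<mu> N) (\<mu>' N) = (INF H\<in>couplings (\<mu> N) (\<mu>' N). ennreal_sqrt (\<integral>\<^sup>+ p. ?d p \<partial>H))"
      by (simp add: wasserstein2_def case_prod_unfold)
    also have "\<dots> \<le> ennreal 1 * transport_dist 1 (inverse lam) (\<pi> 0) (\<pi>' 0)"
      unfolding T
    proof (rule INF_ennreal_sqrt_le)
      fix G assume G: "G \<in> couplings (\<pi> 0) (\<pi>' 0)"
      show "\<exists>H\<in>couplings (\<mu> N) (\<mu>' N). (\<integral>\<^sup>+ p. ?d p \<partial>H) \<le> ennreal (1\<^sup>2) * (\<integral>\<^sup>+ p. ennreal (c p) \<partial>G)"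
        using coupling_pushforward[OF Q G _ XF c_meas' d_meas, of N] le
        by (simp add: \<mu> \<mu>' sets_\<pi>)
    qed simp
    finally show "wasserstein2 (\<mu> N) (\<mu>' N) \<le> transport_dist 1 (inverse lam) (\<pi> 0) (\<pi>' 0)" by simp
  next
    fix N assume "\<tau> * \<sigma> * L\<^sup>2 < 1"
    then have \<kappa>: "0 < \<kappa>" "\<kappa> \<le> 1" using \<tau>\<sigma>(2) by (simp_all add: \<kappa>_def)
    define C where "C = \<kappa> powr (- 1 / 2)"
    have C: "C > 0" using \<kappa> by (simp add: C_def)
    have C2: "C\<^sup>2 = 1 / \<kappa>"
      using \<kappa> by (simp add: C_def power2_eq_square powr_add[symmetric] powr_minus_divide)
    \<comment> \<open>Enlarging the factor of the primal part from \<open>\<kappa>\<close> to 1 is harmless in the bound for \<open>\<kappa> c\<close>, so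
      \<open>C\<^sup>2 = 1 / \<kappa>\<close> turns the weighted contraction into one for the full cost.\<close>
    have le: "ennreal (c (F N (z, w), F N (z', w))) \<le> ennreal (C\<^sup>2 * c (z, z'))" for z z' w
    proof -
      let ?a = "(norm (fst (F N (z, w)) - fst (F N (z', w))))\<^sup>2"
      have "\<kappa> * ?a \<le> 1 * ?a" using \<kappa> by (intro mult_right_mono) auto
      then have "\<kappa> * c (F N (z, w), F N (z', w)) \<le> c (z, z')"
        using contr[of N z w z'] \<kappa> by (simp add: c_def distrib_left)
      then show ?thesis using \<kappa> by (auto simp: C2 field_simps intro!: ennreal_leI)
    qed
    have "transport_dist 1 (inverse lam) (\<pi> N) (\<pi>' N) \<le> ennreal C * transport_dist 1 (inverse lam) (\<pi> 0) (\<pi>' 0)"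
      unfolding T
    proof (rule INF_ennreal_sqrt_le[OF C])
      fix G assume G: "G \<in> couplings (\<pi> 0) (\<pi>' 0)"
      have sG: "sets G = sets (\<pi> 0 \<Otimes>\<^sub>M \<pi> 0)"
        using G sets_pair_measure_cong[OF refl, of "\<pi>' 0" "\<pi> 0" "\<pi> 0"] by (simp add: couplings_def sets_\<pi>)
      have cG: "(\<lambda>p. ennreal (c p)) \<in> borel_measurable G"
        using c_meas' by (simp add: measurable_cong_sets[OF sG refl])
      have sc: "(\<lambda>p. ennreal (C\<^sup>2 * c p)) \<in> borel_measurable (\<pi> 0 \<Otimes>\<^sub>M \<pi> 0)"
        using c_meas' c0 C by (simp add: ennreal_mult)
      have "(\<integral>\<^sup>+ p. ennreal (C\<^sup>2 * c p) \<partial>G) = ennreal (C\<^sup>2) * (\<integral>\<^sup>+ p. ennreal (c p) \<partial>G)"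
        using cG c0 C by (simp add: ennreal_mult nn_integral_cmult)
      then show "\<exists>H\<in>couplings (\<pi> N) (\<pi>' N). (\<integral>\<^sup>+ p. ennreal (c p) \<partial>H) \<le> ennreal (C\<^sup>2) * (\<integral>\<^sup>+ p. ennreal (c p) \<partial>G)"
        using coupling_pushforward[OF Q G _ F' sc c_meas, of N] le
        by (simp add: \<pi>[of N] \<pi>'[of N] sets_\<pi>)
    qed
    then show "transport_dist 1 (inverse lam) (\<pi> N) (\<pi>' N)
        \<le> ennreal ((1 - \<tau> * \<sigma> * L\<^sup>2) powr (- 1 / 2)) * transport_dist 1 (inverse lam) (\<pi> 0) (\<pi>' 0)"
      by (simp add: C_def \<kappa>_def)
  qed
qed

end
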